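(* Let $K$ be an algebraically closed field, let $V$ be a $K$-vector space, and let $A=(V,\bullet)$ and $B=(V,\circ)$ be two associative algebra structures on $V$, where $A$ is the matrix algebra $M_n(K)$ (that is, $A\cong M_n(K)$ as algebras, $n\ge 1$) and $B$ is semisimple. Let $(V,\succ,\prec)$ be a post-associative algebra structure on $(A,B)$. Then $A\cong B$, and either $x\succ y=x\prec y=0$ and $x\circ y=x\bullet y$ for all $x,y\in V$, or $x\bullet y=x\succ y=x\prec y=-x\circ y$ for all $x,y\in V$.
   Context: A semisimple associative algebra is a finite-dimensional associative algebra with zero Jacobson radical. Given two associative products $A=(V,\bullet)$ and $B=(V,\circ)$ on the same $K$-vector space $V$, a post-associative algebra structure on the pair $(A,B)$ is a pair of $K$-bilinear products $\succ,\prec$ on $V$ such that for all $x,y,z\in V$: (1) $x\bullet y-x\circ y=x\succ y+x\prec y$; (2) $(x\bullet y)\succ z=x\succ(y\succ z)$; (3) $x\prec(y\bullet z)=(x\prec y)\prec z$; (4) $x\succ(y\circ z)=(x\succ y)\circ z$; (5) $(x\circ y)\prec z=x\circ(y\prec z)$; (6) $(x\prec y)\circ z=x\circ(y\succ z)$. *)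

theory Defs
  imports "HOL-Analysis.Analysis"
begin

definition bilinear_product :: "('k::field \<Rightarrow> 'v::ab_group_add \<Rightarrow> 'v) \<Rightarrow> ('v \<Rightarrow> 'v \<Rightarrow> 'v) \<Rightarrow> bool" where
  "bilinear_product smul m \<longleftrightarrow>
     (\<forall>x. Vector_Spaces.linear smul smul (\<lambda>y. m x y)) \<and>
     (\<forall>y. Vector_Spaces.linear smul smul (\<lambda>x. m x y))"

text \<open>The vector space is a whole type; no unit element and no finite dimension is required.\<close>

locale associative_algebra = vector_space smul
  for smul :: "'k::field \<Rightarrow> 'v::ab_group_add \<Rightarrow> 'v" +
  fixes mul :: "'v \<Rightarrow> 'v \<Rightarrow> 'v" (infixl \<open>\<otimes>\<close> 70)
  assumes bilinear: "bilinear_product smul (\<otimes>)"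
    and assoc: "(x \<otimes> y) \<otimes> z = x \<otimes> (y \<otimes> z)"
begin

definition left_ideal :: "'v set \<Rightarrow> bool" where
  "left_ideal L \<longleftrightarrow> subspace L \<and> (\<forall>a. \<forall>x\<in>L. a \<otimes> x \<in> L)"

definition maximal_left_ideal :: "'v set \<Rightarrow> bool" where
  "maximal_left_ideal L \<longleftrightarrow>
     left_ideal L \<and> L \<noteq> UNIV \<and> (\<forall>M. left_ideal M \<longrightarrow> L \<subseteq> M \<longrightarrow> M = L \<or> M = UNIV)"

text \<open>
  A left ideal is modular (or regular) if the quotient has a right identity. Jacobson's definition
  of the radical for algebras without a given unit uses the modular maximal left ideals only; if
  there is a unit, every left ideal is modular. If there are no modular maximal left ideals, the
  radical is the whole algebra.
\<close>

definition modular_left_ideal :: "'v set \<Rightarrow> bool" where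
  "modular_left_ideal L \<longleftrightarrow> left_ideal L \<and> (\<exists>e. \<forall>x. x - x \<otimes> e \<in> L)"

definition jacobson_radical :: "'v set" where
  "jacobson_radical = \<Inter>{L. maximal_left_ideal L \<and> modular_left_ideal L}"

lemma jacobson_radical_unital:
  assumes "\<And>x. x \<otimes> e = x"
  shows "jacobson_radical = \<Inter>{L. maximal_left_ideal L}"
proof -
  have "modular_left_ideal L" if "maximal_left_ideal L" for L
    using that assms subspace_0
    unfolding modular_left_ideal_def maximal_left_ideal_def left_ideal_def
    by (metis cancel_comm_monoid_add_class.diff_cancel)
  then show ?thesis
    by (auto simp: jacobson_radical_def)
qed

definition finite_dimensional :: bool where
  "finite_dimensional \<longleftrightarrow> (\<exists>S. finite S \<and> span S = UNIV)"

definition semisimple :: bool where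
  "semisimple \<longleftrightarrow> finite_dimensional \<and> jacobson_radical = {0}"

end

definition algebra_isomorphic ::
  "('k::field \<Rightarrow> 'v::ab_group_add \<Rightarrow> 'v) \<Rightarrow> ('v \<Rightarrow> 'v \<Rightarrow> 'v) \<Rightarrow>
   ('k \<Rightarrow> 'w::ab_group_add \<Rightarrow> 'w) \<Rightarrow> ('w \<Rightarrow> 'w \<Rightarrow> 'w) \<Rightarrow> bool" where
  "algebra_isomorphic smul1 mul1 smul2 mul2 \<longleftrightarrow>
     (\<exists>f. Vector_Spaces.linear smul1 smul2 f \<and> bij f \<and>
          (\<forall>x y. f (mul1 x y) = mul2 (f x) (f y)))"

definition matrix_scale :: "'k::field \<Rightarrow> 'k ^ 'n ^ 'n \<Rightarrow> 'k ^ 'n ^ 'n" where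
  "matrix_scale c M = (\<chi> i j. c * M $ i $ j)"

lemma matrix_algebra:
  "associative_algebra matrix_scale ((**) :: 'k::field ^ 'n ^ 'n \<Rightarrow> 'k ^ 'n ^ 'n \<Rightarrow> 'k ^ 'n ^ 'n)"
proof -
  interpret vector_space "matrix_scale :: 'k \<Rightarrow> 'k ^ 'n ^ 'n \<Rightarrow> 'k ^ 'n ^ 'n"
    by unfold_locales (simp_all add: matrix_scale_def vec_eq_iff algebra_simps)
  show ?thesis
  proof
    show "bilinear_product matrix_scale ((**) :: 'k ^ 'n ^ 'n \<Rightarrow> 'k ^ 'n ^ 'n \<Rightarrow> 'k ^ 'n ^ 'n)"
      unfolding bilinear_product_def
      by (intro conjI allI; unfold_locales;
          simp add: matrix_scale_def matrix_matrix_mult_def vec_eq_iff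
            sum.distrib sum_distrib_left algebra_simps)
    show "(x ** y) ** z = x ** (y ** z)" for x y z :: "'k ^ 'n ^ 'n"
      by (simp add: matrix_mul_assoc)
  qed
qed

locale post_associative_algebra_structure =
  A: associative_algebra smul mulA + B: associative_algebra smul mulB
  for smul :: "'k::field \<Rightarrow> 'v::ab_group_add \<Rightarrow> 'v"
    and mulA :: "'v \<Rightarrow> 'v \<Rightarrow> 'v" (infixl \<open>\<cdot>\<^sub>A\<close> 70)
    and mulB :: "'v \<Rightarrow> 'v \<Rightarrow> 'v" (infixl \<open>\<cdot>\<^sub>B\<close> 70) +
  fixes succ :: "'v \<Rightarrow> 'v \<Rightarrow> 'v" (infixl \<open>\<succ>\<close> 70)
    and prec :: "'v \<Rightarrow> 'v \<Rightarrow> 'v" (infixl \<open>\<prec>\<close> 70)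
  assumes bilinear_succ: "bilinear_product smul (\<succ>)"
    and bilinear_prec: "bilinear_product smul (\<prec>)"
    and post1: "x \<cdot>\<^sub>A y - x \<cdot>\<^sub>B y = x \<succ> y + x \<prec> y"
    and post2: "(x \<cdot>\<^sub>A y) \<succ> z = x \<succ> (y \<succ> z)"
    and post3: "x \<prec> (y \<cdot>\<^sub>A z) = (x \<prec> y) \<prec> z"
    and post4: "x \<succ> (y \<cdot>\<^sub>B z) = (x \<succ> y) \<cdot>\<^sub>B z"
    and post5: "(x \<cdot>\<^sub>B y) \<prec> z = x \<cdot>\<^sub>B (y \<prec> z)"
    and post6: "(x \<prec> y) \<cdot>\<^sub>B z = x \<cdot>\<^sub>B (y \<succ> z)"

end

theory Submission
  imports Defs
begin

text \<open>
  A semisimple algebra \<open>B\<close> has a unit \<open>1\<close>. Putting \<open>1\<close> into the axioms (4) and (6) gives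
  \<open>x \<succ> y = f x \<circ> y\<close> and \<open>x \<prec> y = x \<circ> f y\<close> with \<open>f x = x \<succ> 1\<close>, and then (1) and (2) say that both
  \<open>f\<close> and \<open>f + id\<close> are homomorphisms from \<open>A\<close> to \<open>B\<close>. As \<open>A\<close> is simple and finite-dimensional,
  each of them is zero or bijective. Both cannot be bijective, since then both would map
  the unit \<open>u\<close> of \<open>A\<close> to the unit of \<open>B\<close>, so that \<open>u = (f + id) u - f u = 0\<close>. If \<open>f = 0\<close>, the first
  alternative holds; if \<open>f = - id\<close>, the second one does.
\<close>

section \<open>The unit of a semisimple algebra\<close>

context associative_algebra
begin

lemma bilinear_simps:
  "(x + y) \<otimes> z = x \<otimes> z + y \<otimes> z" "z \<otimes> (x + y) = z \<otimes> x + z \<otimes> y"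
  "(x - y) \<otimes> z = x \<otimes> z - y \<otimes> z" "z \<otimes> (x - y) = z \<otimes> x - z \<otimes> y"
  "(- x) \<otimes> z = - (x \<otimes> z)" "z \<otimes> (- x) = - (z \<otimes> x)"
  "0 \<otimes> z = 0" "z \<otimes> 0 = 0"
  "smul c x \<otimes> z = smul c (x \<otimes> z)" "z \<otimes> smul c x = smul c (z \<otimes> x)"
proof -
  interpret l: Vector_Spaces.linear smul smul "\<lambda>x. x \<otimes> z"
    using bilinear by (auto simp: bilinear_product_def)
  interpret r: Vector_Spaces.linear smul smul "\<lambda>x. z \<otimes> x"
    using bilinear by (auto simp: bilinear_product_def)
  show
    "(x + y) \<otimes> z = x \<otimes> z + y \<otimes> z" "z \<otimes> (x + y) = z \<otimes> x + z \<otimes> y"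
    "(x - y) \<otimes> z = x \<otimes> z - y \<otimes> z" "z \<otimes> (x - y) = z \<otimes> x - z \<otimes> y"
    "(- x) \<otimes> z = - (x \<otimes> z)" "z \<otimes> (- x) = - (z \<otimes> x)"
    "0 \<otimes> z = 0" "z \<otimes> 0 = 0"
    "smul c x \<otimes> z = smul c (x \<otimes> z)" "z \<otimes> smul c x = smul c (z \<otimes> x)"
    by (rule l.add r.add l.diff r.diff l.neg r.neg l.zero r.zero l.scale r.scale)+
qed

text \<open>If \<open>I\<close> is not inside \<open>L\<close>, maximality makes the sum of
  \<open>I\<close> and \<open>L\<close> the whole space. As in the Chinese remainder theorem, the
  right units modulo \<open>I\<close> and modulo \<open>L\<close> then merge into one.\<close>

lemma modular_left_ideal_Int:
  assumes I: "modular_left_ideal I" and L: "maximal_left_ideal L" "modular_left_ideal L"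
  shows "modular_left_ideal (I \<inter> L)"
proof (cases "I \<subseteq> L")
  case True
  then show ?thesis using I by (simp add: Int_absorb2)
next
  case False
  let ?S = "{x + y |x y. x \<in> I \<and> y \<in> L}"
  from I L obtain e e' where e: "\<And>x. x - x \<otimes> e \<in> I" and e': "\<And>x. x - x \<otimes> e' \<in> L"
    unfolding modular_left_ideal_def by blast
  have lI: "left_ideal I" and lL: "left_ideal L"
    using I L by (auto simp: modular_left_ideal_def)
  have sI: "subspace I" and sL: "subspace L"
    using lI lL by (auto simp: left_ideal_def)
  have "a \<otimes> (x + y) \<in> ?S" if "x \<in> I" "y \<in> L" for a x y
    using that lI lL unfolding left_ideal_def bilinear_simps(2) by blast
  then have "left_ideal ?S"
    using subspace_sums[OF sI sL] by (auto simp: left_ideal_def)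
  moreover have "L \<subseteq> ?S"
    using subspace_0[OF sI] by force
  moreover have "I \<subseteq> ?S"
    using subspace_0[OF sL] by force
  moreover have "M = UNIV" if "left_ideal M" "L \<subseteq> M" "I \<subseteq> M" for M
    using that L(1) False unfolding maximal_left_ideal_def by blast
  ultimately have "?S = UNIV"
    by simp
  then have "e - e' \<in> ?S"
    by (simp only: UNIV_I)
  then obtain i l where il: "i \<in> I" "l \<in> L" "e - e' = i + l"
    by blast
  \<comment> \<open>\<open>?d\<close> agrees with \<open>e\<close> modulo \<open>I\<close> and with
    \<open>e'\<close> modulo \<open>L\<close>. Multiplying the errors \<open>i\<close> and
    \<open>l\<close> from the left keeps them in these left ideals, so \<open>?d\<close> is a right
    unit modulo both.\<close>
  let ?d = "e - i"
  have d: "?d = e' + l"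
    using il(3) by (simp add: algebra_simps)
  have "x - x \<otimes> ?d \<in> I" for x
  proof -
    have "(x - x \<otimes> e) + x \<otimes> i \<in> I"
      using il(1) lI by (intro subspace_add[OF sI e]) (simp add: left_ideal_def)
    then show ?thesis by (simp add: bilinear_simps algebra_simps)
  qed
  moreover have "x - x \<otimes> ?d \<in> L" for x
  proof -
    have "(x - x \<otimes> e') - x \<otimes> l \<in> L"
      using il(2) lL by (intro subspace_diff[OF sL e']) (simp add: left_ideal_def)
    then show ?thesis unfolding d by (simp add: bilinear_simps algebra_simps)
  qed
  moreover have "left_ideal (I \<inter> L)"
    using lI lL by (auto simp: left_ideal_def subspace_inter)
  ultimately show ?thesis
    unfolding modular_left_ideal_def by blast
qed

text \<open>If a modular maximal \<open>L\<close> misses \<open>z\<close>, then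
  \<open>span {z}\<close> plus \<open>L\<close> is the whole space and contains the right unit
  \<open>e\<close> modulo \<open>L\<close>. Left multiplication sends this sum into
  \<open>L\<close>, so every \<open>x \<otimes> e\<close>, and with it every \<open>x\<close>, lies
  in \<open>L\<close>.\<close>

lemma annihilated_in_jacobson_radical:
  assumes z: "\<And>y. y \<otimes> z = 0"
  shows "z \<in> jacobson_radical"
  unfolding jacobson_radical_def
proof (safe, rule ccontr)
  fix L assume max: "maximal_left_ideal L" and L: "modular_left_ideal L" and "z \<notin> L"
  obtain e where e: "\<And>x. x - x \<otimes> e \<in> L"
    using L unfolding modular_left_ideal_def by blast
  have lL: "left_ideal L" and sL: "subspace L"
    using L by (auto simp: modular_left_ideal_def left_ideal_def)
  let ?S = "{x + y |x y. x \<in> span {z} \<and> y \<in> L}"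
  have prod: "a \<otimes> (x + y) \<in> L" if "x \<in> span {z}" "y \<in> L" for a x y
    using that lL by (auto simp: span_singleton bilinear_simps z left_ideal_def)
  have "L \<subseteq> ?S"
    using span_zero[of "{z}"] by force
  moreover have "z \<in> ?S"
    using span_base[of z "{z}"] subspace_0[OF sL] by force
  moreover have "left_ideal ?S"
    unfolding left_ideal_def
    using subspace_sums[OF subspace_span sL] prod \<open>L \<subseteq> ?S\<close> by blast
  ultimately have "?S = UNIV"
    using max \<open>z \<notin> L\<close> unfolding maximal_left_ideal_def by blast
  then have "e \<in> ?S"
    by (simp only: UNIV_I)
  then have "x \<otimes> e \<in> L" for x
    using prod by blast
  then have "x \<in> L" for x
    using subspace_add[OF sL e[of x]] by (metis diff_add_cancel)
  then show False
    using max unfolding maximal_left_ideal_def by blast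
qed

lemma finite_dimensional_locale:
  assumes finite_dimensional
  obtains Basis where "finite_dimensional_vector_space smul Basis"
proof -
  obtain S where S: "finite S" "span S = UNIV"
    using assms unfolding finite_dimensional_def by blast
  obtain Basis where "Basis \<subseteq> S" "independent Basis" "S \<subseteq> span Basis"
    using maximal_independent_subset[of S] by blast
  moreover have "span Basis = UNIV"
    using S(2) \<open>S \<subseteq> span Basis\<close> span_minimal[OF _ subspace_span] by blast
  ultimately have "finite_dimensional_vector_space smul Basis"
    using S(1) by unfold_locales (auto intro: finite_subset)
  then show thesis by (rule that)
qed

text \<open>A modular left ideal of least dimension is zero: as the radical is zero, a nonzero
  element would be missed by some modular maximal left ideal, and intersecting with that ideal
  lowers the dimension. Modularity of the zero ideal is a right unit.\<close>

lemma semisimple_unit: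
  assumes semisimple
  obtains e where "\<And>x. x \<otimes> e = x" "\<And>x. e \<otimes> x = x"
proof -
  obtain Basis where "finite_dimensional_vector_space smul Basis"
    using assms finite_dimensional_locale unfolding semisimple_def by blast
  then interpret fd: finite_dimensional_vector_space smul Basis .
  have J: "jacobson_radical = {0}"
    using assms by (simp add: semisimple_def)
  have "modular_left_ideal UNIV"
    by (simp add: modular_left_ideal_def left_ideal_def)
  then obtain I where I: "modular_left_ideal I"
    and min: "\<And>I'. modular_left_ideal I' \<Longrightarrow> dim I \<le> dim I'"
    using ex_has_least_nat[of modular_left_ideal UNIV dim] by blast
  have sub: "subspace I'" if "modular_left_ideal I'" for I'
    using that by (simp add: modular_left_ideal_def left_ideal_def)
  have "x = 0" if "x \<in> I" for x
  proof (rule ccontr)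
    assume "x \<noteq> 0"
    then obtain L where L: "maximal_left_ideal L" "modular_left_ideal L" "x \<notin> L"
      using J unfolding jacobson_radical_def by blast
    have "modular_left_ideal (I \<inter> L)"
      using I L modular_left_ideal_Int by blast
    moreover have "dim (I \<inter> L) < dim I"
      using that L(3) sub[OF I] sub[OF calculation]
      by (intro fd.dim_psubset) (simp add: span_eq_iff[THEN iffD2] psubset_eq, blast)
    ultimately show False
      using min by fastforce
  qed
  then obtain e where e: "\<And>x. x - x \<otimes> e = 0"
    using I unfolding modular_left_ideal_def by blast
  \<comment> \<open>By associativity \<open>y \<otimes> (e \<otimes> x) = (y \<otimes> e) \<otimes>
    x = y \<otimes> x\<close>; the defect of \<open>e\<close> as a left unit thus falls into the
    radical.\<close>
  have "y \<otimes> (x - e \<otimes> x) = 0" for x y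
    using e[of y] by (simp add: bilinear_simps flip: assoc)
  then have "x - e \<otimes> x = 0" for x
    using annihilated_in_jacobson_radical J by blast
  with e show thesis
    by (intro that[of e]) simp_all
qed

end

section \<open>Homomorphisms out of a matrix algebra\<close>

lemma matrix_eq_sum_sandwich:
  fixes M X :: "'k::field ^ 'n ^ 'n"
  assumes "M \<noteq> 0"
  obtains P Q :: "'n \<Rightarrow> 'n \<Rightarrow> 'k ^ 'n ^ 'n"
    where "X = (\<Sum>k\<in>UNIV. \<Sum>l\<in>UNIV. P k l ** (M ** Q k l))"
proof -
  obtain i j where ij: "M $ i $ j \<noteq> 0"
    using assms by (auto simp: vec_eq_iff)
  \<comment> \<open>With matrix units E, \<open>P k l\<close> is
    \<open>X $ k $ l / M $ i $ j\<close> times E_ki and \<open>Q k l\<close> is E_jl. The sandwich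
    picks out the entry \<open>M $ i $ j\<close> and leaves \<open>X $ k $ l\<close> times
    E_kl.\<close>
  define P :: "'n \<Rightarrow> 'n \<Rightarrow> 'k ^ 'n ^ 'n"
    where "P k l = (\<chi> a b. if b = i then if a = k then X $ k $ l / M $ i $ j else 0 else 0)" for k l
  define Q :: "'n \<Rightarrow> 'n \<Rightarrow> 'k ^ 'n ^ 'n"
    where "Q k l = (\<chi> a b. if a = j then if b = l then 1 else 0 else 0)" for k l
  have "(P k l ** (M ** Q k l)) $ a $ b = (if k = a then if l = b then X $ a $ b else 0 else 0)"
    for k l a b
    using ij
    by (simp add: P_def Q_def matrix_matrix_mult_def if_distrib[of "\<lambda>x. _ * x"]
        if_distrib[of "\<lambda>x. x * _"] cong: if_cong)
  then have "X = (\<Sum>k\<in>UNIV. \<Sum>l\<in>UNIV. P k l ** (M ** Q k l))"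
    by (simp add: vec_eq_iff sum.If_cases if_distrib[of "sum _"])
  then show thesis by (rule that)
qed

text \<open>This is simplicity of the matrix algebra: the kernel is a two-sided ideal, and a nonzero
  \<open>M\<close> in it generates every matrix by sandwich sums.\<close>

lemma matrix_hom_zero_or_inj:
  fixes g :: "'k::field ^ 'n ^ 'n \<Rightarrow> 'v::ab_group_add"
  assumes "associative_algebra smul mul"
    and lin: "Vector_Spaces.linear matrix_scale smul g"
    and hom: "\<And>X Y. g (X ** Y) = mul (g X) (g Y)"
  shows "(\<forall>X. g X = 0) \<or> inj g"
proof (cases "inj g")
  case False
  interpret associative_algebra smul mul by fact
  interpret g: Vector_Spaces.linear matrix_scale smul g by fact
  obtain M where M: "M \<noteq> 0" "g M = 0"
    using False g.inj_iff_eq_0 by auto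
  have "g X = 0" for X
  proof -
    obtain P Q :: "'n \<Rightarrow> 'n \<Rightarrow> 'k ^ 'n ^ 'n"
      where X: "X = (\<Sum>k\<in>UNIV. \<Sum>l\<in>UNIV. P k l ** (M ** Q k l))"
      by (rule matrix_eq_sum_sandwich[OF M(1)])
    show ?thesis
      unfolding X by (simp add: g.sum hom M(2) bilinear_simps)
  qed
  then show ?thesis by blast
qed simp

lemma matrix_algebra_hom_zero_or_inj:
  fixes h :: "'v::ab_group_add \<Rightarrow> 'w::ab_group_add"
  assumes iso: "algebra_isomorphic smulA mulA
      matrix_scale ((**) :: 'k::field ^ 'n ^ 'n \<Rightarrow> 'k ^ 'n ^ 'n \<Rightarrow> 'k ^ 'n ^ 'n)"
    and B: "associative_algebra smulB mulB"
    and lin: "Vector_Spaces.linear smulA smulB h"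
    and hom: "\<And>x y. h (mulA x y) = mulB (h x) (h y)"
  shows "(\<forall>x. h x = 0) \<or> inj h"
proof -
  obtain \<phi> :: "'v \<Rightarrow> 'k ^ 'n ^ 'n"
    where \<phi>: "Vector_Spaces.linear smulA matrix_scale \<phi>" "bij \<phi>"
      and \<phi>_hom: "\<And>x y. \<phi> (mulA x y) = \<phi> x ** \<phi> y"
    using iso unfolding algebra_isomorphic_def by blast
  interpret \<phi>: Vector_Spaces.linear smulA matrix_scale \<phi> by fact
  interpret h: Vector_Spaces.linear smulA smulB h by fact
  let ?\<psi> = "inv \<phi>"
  have \<phi>\<psi>: "\<phi> (?\<psi> X) = X" and \<psi>\<phi>: "?\<psi> (\<phi> x) = x" for X x
    using \<phi>(2) by (simp_all add: bij_is_surj surj_f_inv_f bij_is_inj)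
  \<comment> \<open>Precomposing \<open>h\<close> with the inverse isomorphism reduces the claim to
    matrices.\<close>
  have "Vector_Spaces.linear matrix_scale smulB (\<lambda>X. h (?\<psi> X))"
  proof unfold_locales
    fix X Y :: "'k ^ 'n ^ 'n" and c :: 'k
    have "?\<psi> (X + Y) = ?\<psi> X + ?\<psi> Y"
      by (metis \<phi>\<psi> \<psi>\<phi> \<phi>.add)
    then show "h (?\<psi> (X + Y)) = h (?\<psi> X) + h (?\<psi> Y)"
      by (simp add: h.add)
    have "?\<psi> (matrix_scale c X) = smulA c (?\<psi> X)"
      by (metis \<phi>\<psi> \<psi>\<phi> \<phi>.scale)
    then show "h (?\<psi> (matrix_scale c X)) = smulB c (h (?\<psi> X))"
      by (simp add: h.scale)
  qed
  moreover have "h (?\<psi> (X ** Y)) = mulB (h (?\<psi> X)) (h (?\<psi> Y))" for X Y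
    by (metis \<phi>\<psi> \<psi>\<phi> \<phi>_hom hom)
  ultimately have "(\<forall>X. h (?\<psi> X) = 0) \<or> inj (\<lambda>X. h (?\<psi> X))"
    using B by (intro matrix_hom_zero_or_inj)
  then show ?thesis
    by (metis \<psi>\<phi> inj_def)
qed

lemma matrix_algebra_unit:
  fixes smul :: "'k::field \<Rightarrow> 'v::ab_group_add \<Rightarrow> 'v"
  assumes "algebra_isomorphic smul mul
      matrix_scale ((**) :: 'k ^ 'n ^ 'n \<Rightarrow> 'k ^ 'n ^ 'n \<Rightarrow> 'k ^ 'n ^ 'n)"
  obtains u where "u \<noteq> 0" "\<And>x. mul x u = x"
proof -
  obtain \<phi> :: "'v \<Rightarrow> 'k ^ 'n ^ 'n"
    where \<phi>: "Vector_Spaces.linear smul matrix_scale \<phi>" "bij \<phi>"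
      and \<phi>_hom: "\<And>x y. \<phi> (mul x y) = \<phi> x ** \<phi> y"
    using assms unfolding algebra_isomorphic_def by blast
  interpret \<phi>: Vector_Spaces.linear smul matrix_scale \<phi> by fact
  obtain u where u: "\<phi> u = mat 1"
    using \<phi>(2) by (metis bij_pointE)
  have "mul x u = x" for x
    using \<phi>(2) by (metis \<phi>_hom u matrix_mul_rid bij_is_inj injD)
  moreover have "mat 1 \<noteq> (0 :: 'k ^ 'n ^ 'n)"
    by (simp add: vec_eq_iff mat_def)
  then have "u \<noteq> 0"
    using u \<phi>.zero by auto
  ultimately show thesis
    using that by blast
qed

section \<open>Post-associative structures over a unital algebra\<close>

lemma (in post_associative_algebra_structure) unital_hom_form:
  assumes e: "\<And>x. x \<cdot>\<^sub>B e = x" "\<And>x. e \<cdot>\<^sub>B x = x"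
    and f_def: "f = (\<lambda>x. x \<succ> e)"
  shows "x \<succ> y = f x \<cdot>\<^sub>B y" "x \<prec> y = x \<cdot>\<^sub>B f y"
    "f (x \<cdot>\<^sub>A y) = f x \<cdot>\<^sub>B f y"
    "f (x \<cdot>\<^sub>A y) + x \<cdot>\<^sub>A y = (f x + x) \<cdot>\<^sub>B (f y + y)"
proof -
  show s: "x \<succ> y = f x \<cdot>\<^sub>B y" for x y
    unfolding f_def by (metis post4 e(2))
  show p: "x \<prec> y = x \<cdot>\<^sub>B f y" for x y
    unfolding f_def by (metis post6 e(1))
  show h: "f (x \<cdot>\<^sub>A y) = f x \<cdot>\<^sub>B f y"
    unfolding f_def by (metis post2 post4 e(2))
  \<comment> \<open>These are the terms of \<open>(f x + x) \<cdot>\<^sub>B (f y + y)\<close> other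
    than \<open>f x \<cdot>\<^sub>B f y\<close>, which is
    \<open>f (x \<cdot>\<^sub>A y)\<close>.\<close>
  have "x \<cdot>\<^sub>A y = x \<cdot>\<^sub>B y + (f x \<cdot>\<^sub>B y + x \<cdot>\<^sub>B f y)"
    using post1[of x y] by (simp add: s p algebra_simps)
  then show "f (x \<cdot>\<^sub>A y) + x \<cdot>\<^sub>A y = (f x + x) \<cdot>\<^sub>B (f y + y)"
    unfolding h by (simp add: B.bilinear_simps algebra_simps)
qed

theorem corollary3p2:
  fixes smul :: "'k::alg_closed_field \<Rightarrow> 'v::ab_group_add \<Rightarrow> 'v"
    and mulA :: "'v \<Rightarrow> 'v \<Rightarrow> 'v" (infixl \<open>\<cdot>\<^sub>A\<close> 70)
    and mulB :: "'v \<Rightarrow> 'v \<Rightarrow> 'v" (infixl \<open>\<cdot>\<^sub>B\<close> 70)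
    and succ :: "'v \<Rightarrow> 'v \<Rightarrow> 'v" (infixl \<open>\<succ>\<close> 70)
    and prec :: "'v \<Rightarrow> 'v \<Rightarrow> 'v" (infixl \<open>\<prec>\<close> 70)
  assumes "vector_space smul"
    and "associative_algebra smul (\<cdot>\<^sub>A)"
    and "associative_algebra smul (\<cdot>\<^sub>B)"
    and "algebra_isomorphic smul (\<cdot>\<^sub>A)
           matrix_scale ((**) :: 'k ^ 'n ^ 'n \<Rightarrow> 'k ^ 'n ^ 'n \<Rightarrow> 'k ^ 'n ^ 'n)"
    and "associative_algebra.semisimple smul (\<cdot>\<^sub>B)"
    and "post_associative_algebra_structure smul (\<cdot>\<^sub>A) (\<cdot>\<^sub>B) (\<succ>) (\<prec>)"
  shows "algebra_isomorphic smul (\<cdot>\<^sub>A) smul (\<cdot>\<^sub>B) \<and>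
    ((\<forall>x y. x \<succ> y = 0 \<and> x \<prec> y = 0 \<and> x \<cdot>\<^sub>B y = x \<cdot>\<^sub>A y) \<or>
     (\<forall>x y. x \<cdot>\<^sub>A y = x \<succ> y \<and> x \<succ> y = x \<prec> y \<and> x \<prec> y = - (x \<cdot>\<^sub>B y)))"
proof -
  interpret post_associative_algebra_structure smul mulA mulB succ prec by fact
  obtain e where e: "\<And>x. x \<cdot>\<^sub>B e = x" "\<And>x. e \<cdot>\<^sub>B x = x"
    using B.semisimple_unit[OF assms(5)] by blast
  obtain Basis where "finite_dimensional_vector_space smul Basis"
    using assms(5) B.finite_dimensional_locale unfolding B.semisimple_def by blast
  then interpret fd: finite_dimensional_vector_space smul Basis .
  obtain u where u: "u \<noteq> 0" "\<And>x. x \<cdot>\<^sub>A u = x"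
    using matrix_algebra_unit[OF assms(4)] by blast
  define f where "f = (\<lambda>x. x \<succ> e)"
  define g where "g = (\<lambda>x. f x + x)"
  note form = unital_hom_form[OF e f_def]
  have lin_f: "Vector_Spaces.linear smul smul f"
    using bilinear_succ by (simp add: bilinear_product_def f_def)
  interpret f: Vector_Spaces.linear smul smul f by (rule lin_f)
  have lin_g: "Vector_Spaces.linear smul smul g"
    unfolding g_def
    by unfold_locales (simp_all add: f.add f.scale A.scale_right_distrib)
  have g_hom: "g (x \<cdot>\<^sub>A y) = g x \<cdot>\<^sub>B g y" for x y
    by (simp add: g_def form(4))
  \<comment> \<open>By finite dimension an injective \<open>h\<close> is onto, so
    \<open>e = h v\<close> for some \<open>v\<close>. Applying \<open>h\<close> to
    \<open>v \<cdot>\<^sub>A u = v\<close> gives \<open>e \<cdot>\<^sub>B h u = e\<close>.\<close>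
  have unit: "h u = e"
    if "inj h" "Vector_Spaces.linear smul smul h" "\<And>x y. h (x \<cdot>\<^sub>A y) = h x \<cdot>\<^sub>B h y" for h
  proof -
    have "surj h"
      using that fd.linear_inj_imp_surj by blast
    then obtain v where v: "h v = e"
      by (metis surjD)
    show ?thesis
      using that(3)[of v u] by (simp add: u v e)
  qed
  have "\<not> (inj f \<and> inj g)"
  proof
    assume "inj f \<and> inj g"
    then have "f u = e" "g u = e"
      using unit lin_f lin_g form(3) g_hom by blast+
    then show False
      using u(1) by (simp add: g_def)
  qed
  moreover have "(\<forall>x. f x = 0) \<or> inj f"
    using assms(4,3) lin_f form(3) by (rule matrix_algebra_hom_zero_or_inj[where h = f])
  moreover have "(\<forall>x. g x = 0) \<or> inj g"
    using assms(4,3) lin_g g_hom by (rule matrix_algebra_hom_zero_or_inj[where h = g])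
  ultimately consider "\<forall>x. f x = 0" | "\<forall>x. g x = 0"
    by blast
  then show ?thesis
  proof cases
    case 1
    then have "x \<succ> y = 0" "x \<prec> y = 0" for x y
      by (simp_all add: form(1,2) B.bilinear_simps)
    moreover from this have AB: "x \<cdot>\<^sub>B y = x \<cdot>\<^sub>A y" for x y
      using post1[of x y] by simp
    moreover have "algebra_isomorphic smul (\<cdot>\<^sub>A) smul (\<cdot>\<^sub>B)"
      unfolding algebra_isomorphic_def
      by (rule exI[of _ id]) (simp add: A.linear_id AB)
    ultimately show ?thesis by blast
  next
    case 2
    then have "f x = - x" for x
      by (simp add: g_def eq_neg_iff_add_eq_0)
    then have sp: "x \<succ> y = - (x \<cdot>\<^sub>B y)" "x \<prec> y = - (x \<cdot>\<^sub>B y)" for x y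
      by (simp_all add: form(1,2) B.bilinear_simps)
    \<comment> \<open>The right side of axiom (1) is twice \<open>- (x \<cdot>\<^sub>B y)\<close>,
      and one copy cancels; the characteristic does not matter.\<close>
    then have AB: "x \<cdot>\<^sub>A y = - (x \<cdot>\<^sub>B y)" for x y
      using post1[of x y] by (simp add: algebra_simps)
    \<comment> \<open>Negation is the isomorphism, because \<open>- (x \<cdot>\<^sub>A y) = x
      \<cdot>\<^sub>B y = (- x) \<cdot>\<^sub>B (- y)\<close>.\<close>
    have "bij (uminus :: 'v \<Rightarrow> 'v)"
      by (rule o_bij[of uminus]) auto
    then have "algebra_isomorphic smul (\<cdot>\<^sub>A) smul (\<cdot>\<^sub>B)"
      unfolding algebra_isomorphic_def
      by (intro exI[of _ uminus]) (simp add: A.linear_uminus AB B.bilinear_simps)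
    then show ?thesis
      by (simp add: AB sp)
  qed
qed

end
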